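(* If $W$ is a window for a dynamical system on $\mathbb{R}^n$, then the dynamical system has a fixed point lying in $W$. That is: (i) if $f:\mathbb{R}^n\to\mathbb{R}^n$ is a continuous map and $W\subset\mathbb{R}^n$ is a compact set such that the forward orbit under $f$ of every $x\in\mathbb{R}^n$ intersects $W$, then there is $p\in W$ with $f(p)=p$; and (ii) if $\varphi^t$ is a continuous flow on $\mathbb{R}^n$ and $W\subset\mathbb{R}^n$ is a compact set such that the forward orbit under $\varphi^t$ of every $x\in\mathbb{R}^n$ intersects $W$, then there is $p\in W$ with $\varphi^t(p)=p$ for all $t\in\mathbb{R}$.
   Context: A dynamical system on a space $X$ means either a continuous map $f:X\to X$ (not necessarily invertible) or a continuous flow $\varphi^t$ on $X$ (a continuous action $\mathbb{R}\times X\to X$, $(t,x)\mapsto\varphi^t(x)$, of the additive group $\mathbb{R}$). The forward orbit of $x$ is $\{f^k(x):k\ge 0\}$ for a map and $\{\varphi^t(x):t\ge 0\}$ for a flow. A compact set $W\subset X$ is a window if the forward orbit of every $x\in X$ intersects $W$. *)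

theory Defs
  imports "HOL-Analysis.Analysis"
begin

definition continuous_flow :: "(real \<Rightarrow> 'a::topological_space \<Rightarrow> 'a) \<Rightarrow> bool" where
  "continuous_flow \<phi> \<longleftrightarrow>
     continuous_on UNIV (\<lambda>(t, x). \<phi> t x) \<and>
     (\<forall>x. \<phi> 0 x = x) \<and>
     (\<forall>s t x. \<phi> (s + t) x = \<phi> s (\<phi> t x))"

definition map_forward_orbit :: "('a \<Rightarrow> 'a) \<Rightarrow> 'a \<Rightarrow> 'a set" where
  "map_forward_orbit f x = {(f ^^ k) x | k. k \<ge> 0}"

definition flow_forward_orbit :: "(real \<Rightarrow> 'a \<Rightarrow> 'a) \<Rightarrow> 'a \<Rightarrow> 'a set" where
  "flow_forward_orbit \<phi> x = {\<phi> t x | t. t \<ge> 0}"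

(* The first argument assigns to each point its forward orbit, so that the
   notion covers maps and flows alike. *)
definition window :: "('a::topological_space \<Rightarrow> 'a set) \<Rightarrow> 'a set \<Rightarrow> bool" where
  "window orb W \<longleftrightarrow> compact W \<and> (\<forall>x. orb x \<inter> W \<noteq> {})"

end

theory Submission
  imports Defs "HOL-Library.Poly_Mapping" "HOL-Library.Z2"
begin

text \<open>
  A window yields a cube that the iterates of $f$ eventually map into a smaller cube, so for a fine
  cubical grid an approximation of $f$ is a chain map $T$, carried by boxes, of a finite
  complex $X$ into itself with $T^N(X)$ inside a cube for all large $N$. Over the field with two
  elements $\mathrm{tr}(T^2) = \mathrm{tr}(T)$, hence with $N = 2^k$ the trace of $T$ is that of a
  chain map of a contractible cube, which is $1$. Thus some cell lies in its own carrier and $f$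
  nearly fixes it; refine the grid and use compactness. For flows, the maps at time $1/k$ have
  fixed points in a common compact set, and any limit point of these is an equilibrium.
\<close>

section \<open>Chains modulo 2 and traces\<close>

text \<open>No cube need be mapped into itself by \<open>f\<close>; only high iterates are known to
  do this, and a fixed point of an iterate need not be fixed by \<open>f\<close>. The trace carries
  information back from the iterate: modulo 2, squaring a matrix does not change its trace, so a
  power that lands in the cube has the same trace as one step. Working modulo 2 also removes
  orientations: the Lefschetz number, an alternating sum over dimensions, becomes the plain trace on
  all cells together. The region \<open>X\<close> swept out by the cube is finite but may have any
  shape; the homotopy computation takes place on the cube alone. Carriers serve twice: they make the
  chain map exist and, read as a relation between cells, they give pseudo-orbits, so that uniform
  continuity controls where the powers of \<open>T\<close> can go.\<close>

abbreviation gen :: "'c \<Rightarrow> 'c \<Rightarrow>\<^sub>0 bit" where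
  "gen c \<equiv> Poly_Mapping.single c 1"

definition ext :: "('c \<Rightarrow> 'd \<Rightarrow>\<^sub>0 bit) \<Rightarrow> ('c \<Rightarrow>\<^sub>0 bit) \<Rightarrow> 'd \<Rightarrow>\<^sub>0 bit" where
  "ext g x = (\<Sum>c\<in>Poly_Mapping.keys x. g c)"

lemma chain_double [simp]: "x + x = (0 :: 'c \<Rightarrow>\<^sub>0 bit)"
  by (rule poly_mapping_eqI) (simp add: lookup_add)

lemma chain_cancel [simp]: "x + (x + y) = (y :: 'c \<Rightarrow>\<^sub>0 bit)"
  by (simp flip: add.assoc)

lemma chain_eq_sum_gen: "x = (\<Sum>c\<in>Poly_Mapping.keys x. gen c)"
proof (rule poly_mapping_eqI)
  fix k
  have "Poly_Mapping.lookup (\<Sum>c\<in>Poly_Mapping.keys x. gen c) k = (\<Sum>c\<in>Poly_Mapping.keys x. if c = k then 1 else 0)"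
    by (simp add: lookup_sum lookup_single when_def)
  also have "\<dots> = Poly_Mapping.lookup x k"
    by (cases "Poly_Mapping.lookup x k") (auto simp: in_keys_iff)
  finally show "Poly_Mapping.lookup x k = Poly_Mapping.lookup (\<Sum>c\<in>Poly_Mapping.keys x. gen c) k" by simp
qed

text \<open>The support of a sum is the symmetric difference of the supports; the common part is
  counted twice and cancels.\<close>

lemma additive_ext: "Modules.additive (ext g)"
proof
  fix x y :: "'a \<Rightarrow>\<^sub>0 bit"
  let ?A = "Poly_Mapping.keys x" and ?B = "Poly_Mapping.keys y"
  have *: "Poly_Mapping.keys (x + y) = (?A - ?B) \<union> (?B - ?A)"
  proof -
    have "k \<in> Poly_Mapping.keys (x + y) \<longleftrightarrow> k \<in> (?A - ?B) \<union> (?B - ?A)" for k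
      by (cases "Poly_Mapping.lookup x k = 0"; cases "Poly_Mapping.lookup y k = 0")
        (simp_all add: in_keys_iff lookup_add)
    then show ?thesis by blast
  qed
  have A: "sum g ?A = sum g (?A \<inter> ?B) + sum g (?A - ?B)"
    by (rule sum.Int_Diff) simp
  have B: "sum g ?B = sum g (?A \<inter> ?B) + sum g (?B - ?A)"
    using sum.Int_Diff[of ?B g ?A] by (simp add: Int_commute)
  have "sum g ((?A - ?B) \<union> (?B - ?A)) = sum g (?A - ?B) + sum g (?B - ?A)"
    by (rule sum.union_disjoint) auto
  then show "ext g (x + y) = ext g x + ext g y"
    unfolding ext_def * A B by (simp add: ac_simps)
qed

lemmas ext_add = additive.add[OF additive_ext]
lemmas ext_zero [simp] = additive.zero[OF additive_ext]

lemma ext_gen [simp]: "ext g (gen c) = g c"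
  by (simp add: ext_def)

text \<open>Over a prime field additivity is linearity. Only generators in the support of
  \<open>x\<close> are compared, so identities that hold on some cells only can be proved in this
  way too.\<close>

lemma additive_cong_chain:
  assumes "Modules.additive S" "Modules.additive T"
    and "\<And>c. c \<in> Poly_Mapping.keys x \<Longrightarrow> S (gen c) = T (gen c)"
  shows "S x = T x"
proof -
  have "S (\<Sum>c\<in>Poly_Mapping.keys x. gen c) = T (\<Sum>c\<in>Poly_Mapping.keys x. gen c)"
    unfolding additive.sum[OF assms(1)] additive.sum[OF assms(2)]
    by (intro sum.cong refl assms(3))
  then show ?thesis by (simp flip: chain_eq_sum_gen[of x])
qed

lemma additive_comp:
  "Modules.additive S \<Longrightarrow> Modules.additive T \<Longrightarrow> Modules.additive (\<lambda>x. S (T x))"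
  by (simp add: Modules.additive_def)

lemma additive_sum_fun:
  assumes "\<And>i. Modules.additive (S i)"
  shows "Modules.additive (\<lambda>x. \<Sum>i\<in>I. S i x)"
  using assms by (simp add: Modules.additive_def sum.distrib)

lemma additive_ident: "Modules.additive (\<lambda>x. x)"
  by (simp add: Modules.additive_def)

lemma additive_funpow:
  fixes T :: "'a::ab_group_add \<Rightarrow> 'a"
  shows "Modules.additive T \<Longrightarrow> Modules.additive (T ^^ n)"
  unfolding Modules.additive_def by (induction n) simp_all

lemma keys_sum_subset:
  assumes "\<And>i. i \<in> I \<Longrightarrow> Poly_Mapping.keys (g i) \<subseteq> Y"
  shows "Poly_Mapping.keys (sum g I) \<subseteq> Y"
  using assms keys_sum[of g I] by blast

lemma keys_ext_subset:
  assumes "\<And>c. c \<in> Poly_Mapping.keys x \<Longrightarrow> Poly_Mapping.keys (g c) \<subseteq> Y"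
  shows "Poly_Mapping.keys (ext g x) \<subseteq> Y"
  unfolding ext_def by (rule keys_sum_subset) (rule assms)

lemma keys_plus_subset:
  "Poly_Mapping.keys x \<subseteq> Y \<Longrightarrow> Poly_Mapping.keys y \<subseteq> Y \<Longrightarrow> Poly_Mapping.keys (x + y) \<subseteq> Y"
  using Poly_Mapping.keys_add[of x y] by blast

section \<open>Matrices and traces modulo 2\<close>

definition maps_chains :: "'c set \<Rightarrow> 'd set \<Rightarrow> (('c \<Rightarrow>\<^sub>0 bit) \<Rightarrow> 'd \<Rightarrow>\<^sub>0 bit) \<Rightarrow> bool" where
  "maps_chains X Y T \<longleftrightarrow> (\<forall>x. Poly_Mapping.keys x \<subseteq> X \<longrightarrow> Poly_Mapping.keys (T x) \<subseteq> Y)"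

definition trace_on :: "'c set \<Rightarrow> (('c \<Rightarrow>\<^sub>0 bit) \<Rightarrow> 'c \<Rightarrow>\<^sub>0 bit) \<Rightarrow> bit" where
  "trace_on X T = (\<Sum>c\<in>X. Poly_Mapping.lookup (T (gen c)) c)"

lemma lookup_additive:
  assumes "Modules.additive T" "finite X" "Poly_Mapping.keys x \<subseteq> X"
  shows "Poly_Mapping.lookup (T x) d = (\<Sum>c\<in>X. Poly_Mapping.lookup x c * Poly_Mapping.lookup (T (gen c)) d)"
proof -
  have "Poly_Mapping.lookup (T x) d = (\<Sum>c\<in>Poly_Mapping.keys x. Poly_Mapping.lookup (T (gen c)) d)"
    using arg_cong[OF chain_eq_sum_gen[of x], of T]
    by (simp add: additive.sum[OF assms(1)] lookup_sum)
  also have "\<dots> = (\<Sum>c\<in>Poly_Mapping.keys x. Poly_Mapping.lookup x c * Poly_Mapping.lookup (T (gen c)) d)"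
  proof (rule sum.cong)
    fix c assume "c \<in> Poly_Mapping.keys x"
    then have "Poly_Mapping.lookup x c = 1"
      by (cases "Poly_Mapping.lookup x c") (auto simp: in_keys_iff)
    then show "Poly_Mapping.lookup (T (gen c)) d = Poly_Mapping.lookup x c * Poly_Mapping.lookup (T (gen c)) d" by simp
  qed simp
  also have "\<dots> = (\<Sum>c\<in>X. Poly_Mapping.lookup x c * Poly_Mapping.lookup (T (gen c)) d)"
    by (rule sum.mono_neutral_left) (use assms in \<open>auto simp: in_keys_iff\<close>)
  finally show ?thesis .
qed

lemma trace_on_comp:
  assumes "Modules.additive S" "finite X" "maps_chains X X T"
  shows "trace_on X (\<lambda>x. S (T x)) =
    (\<Sum>c\<in>X. \<Sum>d\<in>X. Poly_Mapping.lookup (T (gen c)) d * Poly_Mapping.lookup (S (gen d)) c)"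
  unfolding trace_on_def
  by (intro sum.cong refl lookup_additive) (use assms in \<open>auto simp: maps_chains_def\<close>)

lemma trace_on_commute:
  assumes "Modules.additive S" "Modules.additive T" "finite X" "maps_chains X X S" "maps_chains X X T"
  shows "trace_on X (\<lambda>x. S (T x)) = trace_on X (\<lambda>x. T (S x))"
  unfolding trace_on_comp[OF assms(1,3,5)] trace_on_comp[OF assms(2,3,4)]
  by (subst sum.swap) (simp only: mult.commute)

lemma symmetric_sum_char_2:
  fixes g :: "'i \<Rightarrow> 'i \<Rightarrow> 'b::comm_monoid_add"
  assumes "\<And>b::'b. b + b = 0" "finite I" "\<And>i j. g i j = g j i"
  shows "(\<Sum>i\<in>I. \<Sum>j\<in>I. g i j) = (\<Sum>i\<in>I. g i i)"
  using assms(2)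
proof (induction I)
  case (insert k I)
  have "(\<Sum>i\<in>I. g i k) = (\<Sum>j\<in>I. g k j)"
    by (intro sum.cong refl assms(3))
  then have "(\<Sum>i\<in>insert k I. \<Sum>j\<in>insert k I. g i j) =
      g k k + ((\<Sum>j\<in>I. g k j) + (\<Sum>j\<in>I. g k j)) + (\<Sum>i\<in>I. \<Sum>j\<in>I. g i j)"
    using insert by (simp add: sum.distrib ac_simps)
  then show ?case using insert assms(1) by simp
qed simp

text \<open>The trace of the square sums the products of the entries at (c, d) and (d, c). Off the
  diagonal these come in equal pairs and cancel; on the diagonal \<open>b * b = b\<close>.\<close>

lemma trace_on_square:
  assumes "Modules.additive T" "finite X" "maps_chains X X T"
  shows "trace_on X (\<lambda>x. T (T x)) = trace_on X T"
proof -
  have "b * b = b" for b :: bit by (cases b) auto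
  then show ?thesis
    unfolding trace_on_comp[OF assms]
    by (subst symmetric_sum_char_2) (simp_all add: assms mult.commute trace_on_def)
qed

lemma maps_chainsD:
  "maps_chains X Y T \<Longrightarrow> Poly_Mapping.keys x \<subseteq> X \<Longrightarrow> Poly_Mapping.keys (T x) \<subseteq> Y"
  by (simp add: maps_chains_def)

lemma maps_chains_comp:
  "maps_chains Y Z S \<Longrightarrow> maps_chains X Y T \<Longrightarrow> maps_chains X Z (\<lambda>x. S (T x))"
  by (simp add: maps_chains_def)

lemma maps_chains_plus:
  "maps_chains X Y S \<Longrightarrow> maps_chains X Y T \<Longrightarrow> maps_chains X Y (\<lambda>x. S x + T x)"
  by (simp add: maps_chains_def keys_plus_subset)

lemma maps_chains_funpow: "maps_chains X X T \<Longrightarrow> maps_chains X X (T ^^ n)"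
  by (induction n) (simp_all add: maps_chains_def)

lemma trace_on_power_two:
  assumes "Modules.additive T" "finite X" "maps_chains X X T"
  shows "trace_on X (T ^^ (2 ^ k)) = trace_on X T"
proof (induction k)
  case (Suc k)
  have "T ^^ (2 ^ Suc k) = (\<lambda>x. (T ^^ (2 ^ k)) ((T ^^ (2 ^ k)) x))"
    by (simp add: mult_2 funpow_add o_def)
  then show ?case
    using trace_on_square[of "T ^^ (2 ^ k)" X] Suc assms
    by (simp add: additive_funpow maps_chains_funpow)
qed simp

lemma trace_on_cong:
  "(\<And>c. c \<in> X \<Longrightarrow> S (gen c) = T (gen c)) \<Longrightarrow> trace_on X S = trace_on X T"
  by (simp add: trace_on_def)

lemma trace_on_plus: "trace_on X (\<lambda>x. S x + T x) = trace_on X S + trace_on X T"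
  by (simp only: trace_on_def lookup_add sum.distrib)

text \<open>Cells outside \<open>Y\<close> occur in no image, so their diagonal entries
  vanish.\<close>

lemma trace_on_restrict:
  assumes "finite X" "Y \<subseteq> X" "maps_chains X Y T"
  shows "trace_on X T = trace_on Y T"
  unfolding trace_on_def
proof (rule sum.mono_neutral_right)
  show "\<forall>c\<in>X - Y. Poly_Mapping.lookup (T (gen c)) c = 0"
  proof
    fix c assume c: "c \<in> X - Y"
    then have "Poly_Mapping.keys (gen c) \<subseteq> X" by auto
    then have "Poly_Mapping.keys (T (gen c)) \<subseteq> Y"
      using assms(3) unfolding maps_chains_def by blast
    then show "Poly_Mapping.lookup (T (gen c)) c = 0" using c by (auto simp: in_keys_iff)
  qed
qed (use assms in auto)

section \<open>Cubical chains\<close>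

text \<open>
  A cell of the cubical grid is encoded by doubled coordinates: an even entry is a vertex of the
  line, an odd entry the open edge between its two even neighbours.
\<close>

definition bdc :: "'n \<Rightarrow> (('n \<Rightarrow> int) \<Rightarrow>\<^sub>0 bit) \<Rightarrow> ('n \<Rightarrow> int) \<Rightarrow>\<^sub>0 bit" where
  "bdc i = ext (\<lambda>c. if odd (c i) then gen (c(i := c i - 1)) + gen (c(i := c i + 1)) else 0)"

definition bd :: "(('n::finite \<Rightarrow> int) \<Rightarrow>\<^sub>0 bit) \<Rightarrow> ('n \<Rightarrow> int) \<Rightarrow>\<^sub>0 bit" where
  "bd x = (\<Sum>i\<in>UNIV. bdc i x)"

text \<open>A closed box as a subcomplex, with corners in undoubled vertex coordinates. The even
  bounds keep all faces of its cells inside.\<close>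

definition block :: "('n \<Rightarrow> int) \<Rightarrow> ('n \<Rightarrow> int) \<Rightarrow> ('n \<Rightarrow> int) set" where
  "block a b = {c. \<forall>i. 2 * a i \<le> c i \<and> c i \<le> 2 * b i}"

text \<open>The chain map of the projection that moves the coordinates in \<open>S\<close> to
  \<open>a\<close>; a cell with an edge in such a direction is flattened and becomes 0. For
  \<open>S = UNIV\<close> this is the augmentation, written as a multiple of one vertex.\<close>

definition collapse :: "('n \<Rightarrow> int) \<Rightarrow> 'n set \<Rightarrow> (('n \<Rightarrow> int) \<Rightarrow>\<^sub>0 bit) \<Rightarrow> ('n \<Rightarrow> int) \<Rightarrow>\<^sub>0 bit" where
  "collapse a S = ext (\<lambda>c. if \<forall>i\<in>S. even (c i) then gen (\<lambda>i. if i \<in> S then 2 * a i else c i) else 0)"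

text \<open>
  The sweep joins a cell to its collapse along coordinate \<open>i\<close>. If the cell lies below \<open>2 * a i\<close>, then
  \<^term>\<open>nat\<close> truncates and the sum is empty.
\<close>

definition sweep :: "('n \<Rightarrow> int) \<Rightarrow> 'n \<Rightarrow> (('n \<Rightarrow> int) \<Rightarrow>\<^sub>0 bit) \<Rightarrow> ('n \<Rightarrow> int) \<Rightarrow>\<^sub>0 bit" where
  "sweep a i = ext (\<lambda>c. if even (c i)
     then \<Sum>k<nat ((c i - 2 * a i) div 2). gen (c(i := 2 * a i + 2 * int k + 1)) else 0)"

lemma additive_bdc: "Modules.additive (bdc i)"
  by (simp add: bdc_def additive_ext)

lemma additive_bd: "Modules.additive bd"
  unfolding bd_def by (rule additive_sum_fun) (rule additive_bdc)

lemma additive_collapse: "Modules.additive (collapse a S)"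
  by (simp add: collapse_def additive_ext)

lemma additive_sweep: "Modules.additive (sweep a i)"
  by (simp add: sweep_def additive_ext)

lemma additive_const_zero: "Modules.additive (\<lambda>x. 0)"
  by (simp add: Modules.additive_def)

lemma cube_linear_simps [simp]:
  "bdc i (x + y) = bdc i x + bdc i y" "bdc i 0 = 0" "bdc i (sum f A) = (\<Sum>a\<in>A. bdc i (f a))"
  "bd (u + v) = bd u + bd v" "bd 0 = 0" "bd (sum g B) = (\<Sum>a\<in>B. bd (g a))"
  "collapse a S (x + y) = collapse a S x + collapse a S y" "collapse a S 0 = 0"
  "collapse a S (sum f A) = (\<Sum>j\<in>A. collapse a S (f j))"
  "sweep a i (x + y) = sweep a i x + sweep a i y" "sweep a i 0 = 0"
  "sweep a i (sum f A) = (\<Sum>j\<in>A. sweep a i (f j))"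
  by (simp_all add: additive.add[OF additive_bdc] additive.add[OF additive_bd]
      additive.add[OF additive_collapse] additive.add[OF additive_sweep]
      additive.zero[OF additive_bdc] additive.zero[OF additive_bd]
      additive.zero[OF additive_collapse] additive.zero[OF additive_sweep]
      additive.sum[OF additive_bdc] additive.sum[OF additive_bd]
      additive.sum[OF additive_collapse] additive.sum[OF additive_sweep])

lemma bdc_gen:
  "bdc i (gen c) = (if odd (c i) then gen (c(i := c i - 1)) + gen (c(i := c i + 1)) else 0)"
  by (simp add: bdc_def)

lemma collapse_gen:
  "collapse a S (gen c) =
     (if \<forall>i\<in>S. even (c i) then gen (\<lambda>i. if i \<in> S then 2 * a i else c i) else 0)"
  by (simp add: collapse_def)

lemma sweep_gen:
  "sweep a i (gen c) = (if even (c i)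
     then \<Sum>k<nat ((c i - 2 * a i) div 2). gen (c(i := 2 * a i + 2 * int k + 1)) else 0)"
  by (simp add: sweep_def)

lemma bdc_bdc_same: "bdc i (bdc i x) = 0"
  by (rule additive_cong_chain[of "\<lambda>x. bdc i (bdc i x)" "\<lambda>x. 0"])
    (auto simp: Modules.additive_def bdc_gen)

lemma bdc_commute: "bdc i (bdc j x) = bdc j (bdc i x)"
proof (cases "i = j")
  case False
  show ?thesis
    by (rule additive_cong_chain[of "\<lambda>x. bdc i (bdc j x)" "\<lambda>x. bdc j (bdc i x)"])
      (use False in \<open>auto simp: Modules.additive_def bdc_gen fun_upd_twist ac_simps\<close>)
qed simp

lemma bd_bd [simp]: "bd (bd x) = 0"
proof -
  have "bd (bd x) = (\<Sum>j\<in>UNIV. \<Sum>i\<in>UNIV. bdc j (bdc i x))"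
    by (simp add: bd_def)
  also have "\<dots> = (\<Sum>i\<in>UNIV. bdc i (bdc i x))"
    by (rule symmetric_sum_char_2) (auto simp: bdc_commute)
  finally show ?thesis by (simp add: bdc_bdc_same)
qed

lemma bdc_sweep_commute:
  assumes "i \<noteq> j"
  shows "bdc j (sweep a i x) = sweep a i (bdc j x)"
  by (rule additive_cong_chain[of "\<lambda>x. bdc j (sweep a i x)" "\<lambda>x. sweep a i (bdc j x)"])
    (use assms in \<open>auto simp: Modules.additive_def bdc_gen sweep_gen fun_upd_twist sum.distrib\<close>)

lemma telescope_chain:
  fixes f :: "nat \<Rightarrow> 'c \<Rightarrow>\<^sub>0 bit"
  shows "(\<Sum>k<m. f k + f (Suc k)) = f m + f 0"
  by (induction m) (simp_all add: ac_simps)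

text \<open>For a vertex coordinate the boundary of the sweep telescopes; for an edge coordinate the
  sweeps of the two ends differ by just that edge. The assumption excludes cells below
  \<open>2 * a i\<close>, where truncation would break the identity.\<close>

lemma bdc_sweep_same:
  assumes "\<And>c. c \<in> Poly_Mapping.keys x \<Longrightarrow> 2 * a i \<le> c i"
  shows "bdc i (sweep a i x) + sweep a i (bdc i x) = x + collapse a {i} x"
proof (rule additive_cong_chain[where x = x])
  show "Modules.additive (\<lambda>x. bdc i (sweep a i x) + sweep a i (bdc i x))"
    by (simp add: Modules.additive_def ac_simps)
  show "Modules.additive (\<lambda>x. x + collapse a {i} x)"
    by (simp add: Modules.additive_def ac_simps)
  fix c assume "c \<in> Poly_Mapping.keys x"
  then have le: "2 * a i \<le> c i" by (rule assms)
  have upd: "(\<lambda>j. if j = i then 2 * a j else c j) = c(i := 2 * a i)" by auto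
  show "bdc i (sweep a i (gen c)) + sweep a i (bdc i (gen c)) = gen c + collapse a {i} (gen c)"
  proof (cases "even (c i)")
    case True
    define m where "m = nat ((c i - 2 * a i) div 2)"
    have m: "c i = 2 * a i + 2 * int m" using True le by (auto simp: m_def)
    have "bdc i (sweep a i (gen c)) =
        (\<Sum>k<m. gen (c(i := 2 * a i + 2 * int k)) + gen (c(i := 2 * a i + 2 * int (Suc k))))"
      using True by (simp add: sweep_gen bdc_gen m_def algebra_simps)
    also have "\<dots> = gen (c(i := 2 * a i + 2 * int m)) + gen (c(i := 2 * a i))"
      by (subst telescope_chain) simp
    finally show ?thesis
      using True by (simp add: bdc_gen collapse_gen upd flip: m)
  next
    case False
    define m where "m = nat ((c i - 1 - 2 * a i) div 2)"
    have m: "c i = 2 * a i + 2 * int m + 1" using False le by (auto simp: m_def elim!: oddE)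
    then have "nat ((c i - 1 - 2 * a i) div 2) = m" "nat ((c i + 1 - 2 * a i) div 2) = Suc m"
      by auto
    then have "sweep a i (bdc i (gen c)) = gen (c(i := 2 * a i + 2 * int m + 1))"
      using False by (simp add: bdc_gen sweep_gen ac_simps)
    then show ?thesis
      using False by (simp add: sweep_gen collapse_gen flip: m)
  qed
qed

text \<open>In every direction other than \<open>i\<close> the two terms agree and cancel modulo
  2.\<close>

lemma bd_sweep:
  assumes "\<And>c. c \<in> Poly_Mapping.keys x \<Longrightarrow> 2 * a i \<le> c i"
  shows "bd (sweep a i x) + sweep a i (bd x) = x + collapse a {i} x"
proof -
  have "bd (sweep a i x) + sweep a i (bd x) = (\<Sum>j\<in>UNIV. bdc j (sweep a i x) + sweep a i (bdc j x))"
    by (simp add: bd_def sum.distrib)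
  also have "\<dots> = (\<Sum>j\<in>{i}. bdc j (sweep a i x) + sweep a i (bdc j x))"
    by (rule sum.mono_neutral_right) (auto simp: bdc_sweep_commute)
  also have "\<dots> = x + collapse a {i} x"
    by (simp add: bdc_sweep_same assms)
  finally show ?thesis .
qed

lemma collapse_insert:
  assumes "i \<notin> S"
  shows "collapse a (insert i S) x = collapse a S (collapse a {i} x)"
proof (rule additive_cong_chain[where x = x])
  show "Modules.additive (\<lambda>x. collapse a S (collapse a {i} x))"
    by (simp add: Modules.additive_def ac_simps)
  fix c
  show "collapse a (insert i S) (gen c) = collapse a S (collapse a {i} (gen c))"
    using assms by (auto simp: collapse_gen intro!: arg_cong[of _ _ gen])
qed (rule additive_collapse additive_const_zero)+

lemma collapse_UNIV_collapse: "collapse a UNIV (collapse b S x) = collapse a UNIV x"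
proof (rule additive_cong_chain[where x = x])
  show "Modules.additive (\<lambda>x. collapse a UNIV (collapse b S x))"
    by (simp add: Modules.additive_def ac_simps)
  show "collapse a UNIV (collapse b S (gen c)) = collapse a UNIV (gen c)" for c
    by (auto simp: collapse_gen)
qed (rule additive_collapse additive_const_zero)+

lemma collapse_UNIV_sweep: "collapse a UNIV (sweep b i x) = 0"
proof (rule additive_cong_chain[where x = x])
  show "Modules.additive (\<lambda>x. collapse a UNIV (sweep b i x))"
    by (simp add: Modules.additive_def ac_simps)
  show "collapse a UNIV (sweep b i (gen c)) = 0" for c
    by (auto simp: collapse_gen sweep_gen intro!: sum.neutral exI[of _ i])
qed (rule additive_collapse additive_const_zero)+

text \<open>Opposite facets of a cell have the same parities, hence the same collapse, and
  cancel.\<close>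

lemma collapse_UNIV_bd: "collapse a UNIV (bd x) = 0"
proof -
  have "collapse a UNIV (bdc i x) = 0" for i
  proof (rule additive_cong_chain[where x = x])
    show "Modules.additive (\<lambda>x. collapse a UNIV (bdc i x))"
      by (simp add: Modules.additive_def ac_simps)
    show "collapse a UNIV (bdc i (gen c)) = 0" for c
    proof -
      have "(\<forall>j. even ((c(i := c i - 1)) j)) \<longleftrightarrow> (\<forall>j. even ((c(i := c i + 1)) j))"
        by auto
      then show ?thesis by (simp add: collapse_gen bdc_gen del: fun_upd_apply)
    qed
  qed (rule additive_collapse additive_const_zero)+
  then show ?thesis by (simp add: bd_def)
qed

section \<open>Blocks and their contractions\<close>

lemma maps_chains_ext:
  "(\<And>c. c \<in> X \<Longrightarrow> Poly_Mapping.keys (g c) \<subseteq> Y) \<Longrightarrow> maps_chains X Y (ext g)"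
  by (auto simp: maps_chains_def intro!: keys_ext_subset)

lemma maps_chains_bdc: "maps_chains (block a b) (block a b) (bdc i)"
  unfolding bdc_def
proof (rule maps_chains_ext)
  fix c assume c: "c \<in> block a b"
  have "2 * a i \<le> c i - 1" "c i + 1 \<le> 2 * b i" if "odd (c i)"
  proof -
    have "2 * a i \<le> c i" "c i \<le> 2 * b i" using c by (auto simp: block_def)
    then show "2 * a i \<le> c i - 1" "c i + 1 \<le> 2 * b i" using that by presburger+
  qed
  with c have "c(i := c i - 1) \<in> block a b" "c(i := c i + 1) \<in> block a b" if "odd (c i)"
    using that by (auto simp: block_def)
  then show "Poly_Mapping.keys (if odd (c i) then gen (c(i := c i - 1)) + gen (c(i := c i + 1)) else 0)
      \<subseteq> block a b"
    by (simp add: keys_plus_subset)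
qed

lemma maps_chains_bd: "maps_chains (block a b) (block a b) bd"
  using maps_chains_bdc[of a b] unfolding bd_def maps_chains_def
  by (auto intro!: keys_sum_subset)

lemma maps_chains_collapse:
  assumes "\<And>i. a i \<le> b i"
  shows "maps_chains (block a b) (block a b) (collapse a S)"
  unfolding collapse_def by (rule maps_chains_ext) (use assms in \<open>auto simp: block_def\<close>)

lemma maps_chains_sweep: "maps_chains (block a b) (block a b) (sweep a i)"
  unfolding sweep_def
proof (rule maps_chains_ext)
  fix c assume c: "c \<in> block a b"
  have "2 * a i + 2 * int k + 1 \<le> 2 * b i" if "k < nat ((c i - 2 * a i) div 2)" for k
  proof -
    have "c i \<le> 2 * b i" using c by (auto simp: block_def)
    moreover have "int k < (c i - 2 * a i) div 2" using that by linarith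
    ultimately show ?thesis by presburger
  qed
  with c show "Poly_Mapping.keys (if even (c i)
     then \<Sum>k<nat ((c i - 2 * a i) div 2). gen (c(i := 2 * a i + 2 * int k + 1)) else 0) \<subseteq> block a b"
    by (auto intro!: keys_sum_subset simp: block_def split: if_splits)
qed

text \<open>A chain homotopy on the block between the identity and \<open>collapse a S\<close>. The
  clause on \<open>collapse o' UNIV\<close> reflects that a homotopy raises dimension; it makes the
  chains filled in by \<open>H\<close> have augmentation zero.\<close>

definition contracts ::
  "('n::finite \<Rightarrow> int) \<Rightarrow> ('n \<Rightarrow> int) \<Rightarrow> 'n set \<Rightarrow> ((('n \<Rightarrow> int) \<Rightarrow>\<^sub>0 bit) \<Rightarrow> ('n \<Rightarrow> int) \<Rightarrow>\<^sub>0 bit) \<Rightarrow> bool" where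
  "contracts a b S H \<longleftrightarrow> Modules.additive H \<and> maps_chains (block a b) (block a b) H \<and>
     (\<forall>o' x. collapse o' UNIV (H x) = 0) \<and>
     (\<forall>x. Poly_Mapping.keys x \<subseteq> block a b \<longrightarrow> bd (H x) + H (bd x) = x + collapse a S x)"

lemma contractsD:
  assumes "contracts a b S H"
  shows "Modules.additive H" "maps_chains (block a b) (block a b) H" "collapse o' UNIV (H x) = 0"
    "Poly_Mapping.keys x \<subseteq> block a b \<Longrightarrow> bd (H x) + H (bd x) = x + collapse a S x"
  using assms by (simp_all add: contracts_def)

text \<open>One coordinate is collapsed at a time. Homotopies of successive projections add up once
  the new sweep is followed by the collapse already treated.\<close>

lemma block_contraction:
  fixes a b :: "'n::finite \<Rightarrow> int"
  assumes le: "\<And>i. a i \<le> b i"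
  shows "\<exists>H. contracts a b S H"
  using finite[of S]
proof (induction S)
  case empty
  have "collapse a {} x = x" for x
    by (rule additive_cong_chain[OF additive_collapse additive_ident]) (simp add: collapse_gen)
  then show ?case
    by (intro exI[of _ "\<lambda>x. 0"]) (simp add: contracts_def maps_chains_def additive_const_zero)
next
  case (insert i S)
  then obtain H where "contracts a b S H" by blast
  note H = contractsD[OF this]
  let ?H = "\<lambda>x. H x + collapse a S (sweep a i x)"
  have collapse_eq: "collapse a S x = x + (bd (H x) + H (bd x))"
    if "Poly_Mapping.keys x \<subseteq> block a b" for x
    unfolding H(4)[OF that] by simp
  have bd_in: "Poly_Mapping.keys (bd x) \<subseteq> block a b" if "Poly_Mapping.keys x \<subseteq> block a b" for x
    by (rule maps_chainsD[OF maps_chains_bd that])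
  \<comment> \<open>By the homotopy identity the collapse is the identity plus
    \<open>bd H + H bd\<close>, which commutes with \<open>bd\<close> because \<open>bd\<close>
    squares to zero.\<close>
  have chain_map: "bd (collapse a S x) = collapse a S (bd x)"
    if "Poly_Mapping.keys x \<subseteq> block a b" for x
    unfolding collapse_eq[OF that] collapse_eq[OF bd_in[OF that]]
    by (simp add: additive.zero[OF H(1)])
  have "bd (?H x) + ?H (bd x) = x + collapse a (insert i S) x"
    if x: "Poly_Mapping.keys x \<subseteq> block a b" for x
  proof -
    have sw: "Poly_Mapping.keys (sweep a i x) \<subseteq> block a b"
      by (rule maps_chainsD[OF maps_chains_sweep x])
    have *: "bd (sweep a i x) + sweep a i (bd x) = x + collapse a {i} x"
      by (rule bd_sweep) (use x in \<open>auto simp: block_def\<close>)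
    have "bd (?H x) + ?H (bd x) =
        (bd (H x) + H (bd x)) + collapse a S (bd (sweep a i x) + sweep a i (bd x))"
      unfolding cube_linear_simps chain_map[OF sw] by (simp only: ac_simps)
    also have "\<dots> = x + collapse a (insert i S) x"
      unfolding * H(4)[OF x] collapse_insert[OF insert.hyps(2)]
      by (simp add: ac_simps)
    finally show ?thesis .
  qed
  moreover have "Modules.additive ?H"
    by (simp add: Modules.additive_def additive.add[OF H(1)] ac_simps)
  moreover have "maps_chains (block a b) (block a b) ?H"
    by (rule maps_chains_plus[OF H(2) maps_chains_comp[OF maps_chains_collapse[OF le] maps_chains_sweep]])
  moreover have "collapse o' UNIV (?H x) = 0" for o' x
    by (simp add: H(3) collapse_UNIV_collapse collapse_UNIV_sweep)
  ultimately show ?case by (intro exI[of _ ?H]) (simp add: contracts_def)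
qed

section \<open>Chain maps carried by boxes\<close>

lemma face_cases:
  assumes "d \<in> Poly_Mapping.keys (bd (gen c))"
  shows "\<exists>i. odd (c i) \<and> (d = c(i := c i - 1) \<or> d = c(i := c i + 1))"
proof -
  have "d \<in> (\<Union>i. Poly_Mapping.keys (bdc i (gen c)))"
    using assms keys_sum unfolding bd_def by fastforce
  then obtain i where "d \<in> Poly_Mapping.keys (bdc i (gen c))" by blast
  then show ?thesis
    using Poly_Mapping.keys_add[of "gen (c(i := c i - 1))" "gen (c(i := c i + 1))"]
    by (auto simp: bdc_gen split: if_splits)
qed

text \<open>The method of acyclic carriers. By \<open>mono\<close> the values on the faces of
  \<open>c\<close> add up to a cycle in the box of \<open>c\<close>; its augmentation is zero, so
  the contraction of that box fills it. Preserving the augmentation matters for edges: their ends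
  must go to an even number of vertices in total.\<close>

lemma carrier_chain_map:
  fixes lo hi :: "('n::finite \<Rightarrow> int) \<Rightarrow> 'n \<Rightarrow> int"
  assumes le: "\<And>c i. lo c i \<le> hi c i"
    and mono: "\<And>c d i. d \<in> Poly_Mapping.keys (bd (gen c)) \<Longrightarrow> lo c i \<le> lo d i \<and> hi d i \<le> hi c i"
  shows "\<exists>\<phi>. \<forall>c. Poly_Mapping.keys (\<phi> c) \<subseteq> block (lo c) (hi c) \<and> bd (\<phi> c) = ext \<phi> (bd (gen c)) \<and>
    collapse (\<lambda>_. 0) UNIV (\<phi> c) = collapse (\<lambda>_. 0) UNIV (gen c)"
proof -
  let ?dim = "\<lambda>c::'n \<Rightarrow> int. card {i. odd (c i)}"
  let ?aug = "collapse (\<lambda>_. 0) UNIV :: (('n \<Rightarrow> int) \<Rightarrow>\<^sub>0 bit) \<Rightarrow> _"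
  let ?good = "\<lambda>\<phi> c. Poly_Mapping.keys (\<phi> c) \<subseteq> block (lo c) (hi c) \<and> bd (\<phi> c) = ext \<phi> (bd (gen c)) \<and>
    ?aug (\<phi> c) = ?aug (gen c)"
  have "\<forall>c. \<exists>H. contracts (lo c) (hi c) UNIV H"
    by (intro allI block_contraction le)
  from choice[OF this] obtain H where "\<And>c. contracts (lo c) (hi c) UNIV (H c)" by blast
  note H = contractsD[OF this]
  have face_dim: "Suc (?dim d) = ?dim c" if d: "d \<in> Poly_Mapping.keys (bd (gen c))" for c d
  proof -
    obtain i where i: "odd (c i)" "d = c(i := c i - 1) \<or> d = c(i := c i + 1)"
      using face_cases[OF d] by metis
    then have "odd (d j) \<longleftrightarrow> j \<noteq> i \<and> odd (c j)" for j
      by (cases "j = i") auto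
    with i(1) have "{j. odd (c j)} = insert i {j. odd (d j)}" "i \<notin> {j. odd (d j)}"
      by auto
    then show ?thesis by simp
  qed
  have "\<exists>\<phi>. \<forall>c. ?dim c \<le> n \<longrightarrow> ?good \<phi> c" for n
  proof (induction n)
    case 0
    have *: "?good (\<lambda>c. gen (\<lambda>i. 2 * lo c i)) c" if "?dim c = 0" for c
    proof -
      have "even (c i)" for i using that by auto
      then show ?thesis
        using le by (auto simp: block_def bd_def bdc_gen collapse_gen)
    qed
    show ?case using * by (intro exI[of _ "\<lambda>c. gen (\<lambda>i. 2 * lo c i)"]) simp
  next
    case (Suc n)
    then obtain \<phi> where "\<forall>c. ?dim c \<le> n \<longrightarrow> ?good \<phi> c" ..
    then have \<phi>: "\<And>c. ?dim c \<le> n \<Longrightarrow> ?good \<phi> c" by simp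
    \<comment> \<open>Cells of dimension above \<open>Suc n\<close> get values as well; nothing is
      claimed of these, and the next stage replaces them.\<close>
    define \<psi> where "\<psi> c = (if ?dim c \<le> n then \<phi> c else H c (ext \<phi> (bd (gen c))))" for c
    have ext_eq: "ext \<psi> (bd (gen c)) = ext \<phi> (bd (gen c))" if "?dim c \<le> Suc n" for c
      unfolding ext_def by (rule sum.cong) (use that in \<open>auto simp: \<psi>_def dest!: face_dim\<close>)
    have "?good \<psi> c" if c: "?dim c \<le> Suc n" for c
    proof (cases "?dim c \<le> n")
      case True
      then show ?thesis using \<phi>[OF True] ext_eq[OF c] by (simp add: \<psi>_def)
    next
      case False
      let ?z = "ext \<phi> (bd (gen c))"
      have face: "?good \<phi> d" if "d \<in> Poly_Mapping.keys (bd (gen c))" for d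
        using \<phi>[of d] face_dim[OF that] c by simp
      have z: "Poly_Mapping.keys ?z \<subseteq> block (lo c) (hi c)"
      proof (rule keys_ext_subset)
        fix d assume d: "d \<in> Poly_Mapping.keys (bd (gen c))"
        have "block (lo d) (hi d) \<subseteq> block (lo c) (hi c)"
        proof
          fix e assume "e \<in> block (lo d) (hi d)"
          moreover have "lo c i \<le> lo d i \<and> hi d i \<le> hi c i" for i by (rule mono[OF d])
          ultimately show "e \<in> block (lo c) (hi c)"
            unfolding block_def by (smt (verit) mem_Collect_eq)
        qed
        then show "Poly_Mapping.keys (\<phi> d) \<subseteq> block (lo c) (hi c)" using face[OF d] by blast
      qed
      have "bd ?z = ext \<phi> (bd (bd (gen c)))"
        by (rule additive_cong_chain[of "\<lambda>x. bd (ext \<phi> x)" "\<lambda>x. ext \<phi> (bd x)"])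
          (simp_all add: Modules.additive_def ext_add face)
      then have bdz: "bd ?z = 0" by simp
      have "?aug ?z = ?aug (bd (gen c))"
        by (rule additive_cong_chain[of "\<lambda>x. ?aug (ext \<phi> x)" ?aug])
          (simp_all add: Modules.additive_def ext_add face)
      then have "?aug ?z = 0" by (simp add: collapse_UNIV_bd)
      then have "collapse (lo c) UNIV ?z = 0"
        using collapse_UNIV_collapse[of "lo c" "\<lambda>_. 0" UNIV ?z] by simp
      then have 1: "bd (H c ?z) = ?z"
        using H(4)[OF z] bdz by (simp add: additive.zero[OF H(1)])
      have 2: "Poly_Mapping.keys (H c ?z) \<subseteq> block (lo c) (hi c)"
        by (rule maps_chainsD[OF H(2) z])
      have "\<not> (\<forall>i. even (c i))"
      proof
        assume "\<forall>i. even (c i)"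
        then have "{i. odd (c i)} = {}" by simp
        with False show False by simp
      qed
      then have "?aug (gen c) = 0" by (auto simp: collapse_gen)
      with 1 2 False show ?thesis by (simp add: \<psi>_def[of c] ext_eq[OF c] H(3))
    qed
    then show ?case by (intro exI[of _ \<psi>]) simp
  qed
  then obtain \<phi> where \<phi>: "\<forall>c. ?dim c \<le> CARD('n) \<longrightarrow> ?good \<phi> c" ..
  have "?dim c \<le> CARD('n)" for c by (rule card_mono) auto
  with \<phi> show ?thesis by (intro exI[of _ \<phi>]) simp
qed


text \<open>A Lefschetz argument. The contraction \<open>H\<close> of the block writes
  \<open>P\<close> as \<open>bd P H + P H bd + P ?E\<close>. By cyclicity of the trace the first two
  terms have equal traces, which cancel modulo 2, so only the last one counts. An odd trace of
  \<open>T\<close> then forces a nonzero diagonal entry.\<close>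

lemma fixed_cell:
  fixes lo hi :: "('n::finite \<Rightarrow> int) \<Rightarrow> 'n \<Rightarrow> int"
  defines "r \<equiv> {(c, e). e \<in> block (lo c) (hi c)}"
  assumes le: "\<And>c i. lo c i \<le> hi c i"
    and mono: "\<And>c d i. d \<in> Poly_Mapping.keys (bd (gen c)) \<Longrightarrow> lo c i \<le> lo d i \<and> hi d i \<le> hi c i"
    and AB: "\<And>i. A i \<le> B i"
    and X: "finite X" "block A B \<subseteq> X" "r `` X \<subseteq> X"
    and absorb: "(r ^^ (2 ^ k)) `` X \<subseteq> block A B"
  obtains c where "c \<in> X" "(c, c) \<in> r"
proof -
  let ?aug = "collapse (\<lambda>_. 0) UNIV :: (('n \<Rightarrow> int) \<Rightarrow>\<^sub>0 bit) \<Rightarrow> _"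
  let ?Y = "block A B"
  let ?E = "collapse A UNIV"
  obtain \<phi> where "\<forall>c. Poly_Mapping.keys (\<phi> c) \<subseteq> block (lo c) (hi c) \<and> bd (\<phi> c) = ext \<phi> (bd (gen c)) \<and>
    ?aug (\<phi> c) = ?aug (gen c)"
    using carrier_chain_map[of lo hi, OF le mono] ..
  then have \<phi>: "\<And>c. Poly_Mapping.keys (\<phi> c) \<subseteq> block (lo c) (hi c)"
    "\<And>c. bd (\<phi> c) = ext \<phi> (bd (gen c))" "\<And>c. ?aug (\<phi> c) = ?aug (gen c)"
    by simp_all
  define T where "T = ext \<phi>"
  define P where "P = T ^^ (2 ^ k)"
  have T: "Modules.additive T" by (simp add: T_def additive_ext)
  have P: "Modules.additive P" by (simp add: P_def T additive_funpow)
  have keys_T: "Poly_Mapping.keys (T x) \<subseteq> r `` S" if "Poly_Mapping.keys x \<subseteq> S" for x S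
    unfolding T_def
  proof (rule keys_ext_subset)
    fix c assume "c \<in> Poly_Mapping.keys x"
    with that have "block (lo c) (hi c) \<subseteq> r `` S" by (auto simp: r_def)
    then show "Poly_Mapping.keys (\<phi> c) \<subseteq> r `` S" using \<phi>(1)[of c] by (rule order_trans[rotated])
  qed
  have keys_pow: "Poly_Mapping.keys ((T ^^ n) x) \<subseteq> (r ^^ n) `` X"
    if "Poly_Mapping.keys x \<subseteq> X" for x n
  proof (induction n)
    case (Suc n)
    have "Poly_Mapping.keys ((T ^^ Suc n) x) \<subseteq> r `` ((r ^^ n) `` X)"
      using keys_T[OF Suc] by simp
    then show ?case unfolding relpow.simps relcomp_Image .
  qed (use that in simp)
  have TX: "maps_chains X X T"
    unfolding maps_chains_def by (intro allI impI order_trans[OF keys_T X(3)])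
  have PX: "maps_chains X ?Y P"
    unfolding maps_chains_def P_def by (intro allI impI order_trans[OF keys_pow absorb])
  then have PY: "maps_chains ?Y ?Y P"
    using X(2) unfolding maps_chains_def by (meson order_trans)
  have Y: "finite ?Y" using X finite_subset by blast
  have bd_T: "bd (T x) = T (bd x)" for x
    by (rule additive_cong_chain[of "\<lambda>x. bd (T x)" "\<lambda>x. T (bd x)"])
      (simp_all add: Modules.additive_def T_def ext_add \<phi>)
  have aug_T: "?aug (T x) = ?aug x" for x
    by (rule additive_cong_chain[of "\<lambda>x. ?aug (T x)" ?aug])
      (simp_all add: Modules.additive_def T_def ext_add \<phi>)
  have bd_P: "bd (P x) = P (bd x)" for x
  proof -
    have "bd ((T ^^ n) x) = (T ^^ n) (bd x)" for n by (induction n) (simp_all add: bd_T)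
    then show ?thesis by (simp add: P_def)
  qed
  have aug_P: "?aug (P x) = ?aug x" for x
  proof -
    have "?aug ((T ^^ n) x) = ?aug x" for n by (induction n) (simp_all add: aug_T)
    then show ?thesis by (simp add: P_def)
  qed
  have E_P: "?E (P x) = ?E x" for x
    using arg_cong[OF aug_P[of x], of ?E] by (simp only: collapse_UNIV_collapse)
  obtain H where "contracts A B UNIV H"
    using block_contraction[of A B, OF AB] ..
  note H = contractsD[OF this]
  have PH: "Modules.additive (\<lambda>x. P (H x))" by (rule additive_comp[OF P H(1)])
  have "trace_on ?Y P = trace_on ?Y (\<lambda>x. (bd (P (H x)) + P (H (bd x))) + P (?E x))"
  proof (rule trace_on_cong)
    fix c assume "c \<in> ?Y"
    then have "bd (H (gen c)) + H (bd (gen c)) = gen c + ?E (gen c)"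
      by (intro H(4)) auto
    then have "gen c = (bd (H (gen c)) + H (bd (gen c))) + ?E (gen c)"
      by (simp add: add.assoc)
    then have "P (gen c) = P ((bd (H (gen c)) + H (bd (gen c))) + ?E (gen c))"
      by (rule arg_cong)
    then show "P (gen c) = (bd (P (H (gen c))) + P (H (bd (gen c)))) + P (?E (gen c))"
      by (simp only: additive.add[OF P] bd_P)
  qed
  moreover have "trace_on ?Y (\<lambda>x. bd (P (H x))) = trace_on ?Y (\<lambda>x. P (H (bd x)))"
    by (rule trace_on_commute[OF additive_bd PH Y maps_chains_bd maps_chains_comp[OF PY H(2)]])
  \<comment> \<open>After the factors are exchanged \<open>P\<close> disappears, since it preserves
    augmentation, and \<open>?E\<close> has a single nonzero diagonal entry, at the corner
    \<open>2 * A\<close>.\<close>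
  moreover have "trace_on ?Y (\<lambda>x. P (?E x)) = 1"
  proof -
    have "trace_on ?Y (\<lambda>x. P (?E x)) = trace_on ?Y (\<lambda>x. ?E (P x))"
      by (rule trace_on_commute[OF P additive_collapse Y PY maps_chains_collapse[OF AB]])
    also have "\<dots> = (\<Sum>c\<in>?Y. if c = (\<lambda>i. 2 * A i) then 1 else 0)"
      unfolding trace_on_def E_P
      by (rule sum.cong) (auto simp: collapse_gen lookup_single when_def)
    also have "\<dots> = 1"
      using Y AB by (simp add: block_def)
    finally show ?thesis .
  qed
  ultimately have "trace_on ?Y P = 1"
    unfolding trace_on_plus by simp
  then have "trace_on X T = 1"
    using trace_on_restrict[OF X(1,2) PX] trace_on_power_two[OF T X(1) TX, of k] by (simp add: P_def)
  then have "(\<Sum>c\<in>X. Poly_Mapping.lookup (T (gen c)) c) \<noteq> 0"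
    by (simp add: trace_on_def)
  then obtain c where "c \<in> X" "Poly_Mapping.lookup (T (gen c)) c \<noteq> 0"
    by (rule sum.not_neutral_contains_not_neutral)
  moreover from this have "c \<in> block (lo c) (hi c)"
    using \<phi>(1)[of c] by (auto simp: T_def in_keys_iff simp del: bit_not_zero_iff)
  ultimately show ?thesis using that by (simp add: r_def)
qed

section \<open>Grid approximation\<close>

text \<open>A path in \<open>r\<close> is a pseudo-orbit, whose error stays small for boundedly many
  steps. The bound \<open>\<epsilon>\<close> precedes \<open>p\<close> and \<open>r\<close> because
  the grid and its carriers are chosen only afterwards.\<close>

lemma shadowing:
  fixes g :: "'a::metric_space \<Rightarrow> 'a"
  assumes "uniformly_continuous_on UNIV g" "\<eta> > 0"
  shows "\<exists>\<epsilon>>0. \<forall>(p :: 'c \<Rightarrow> 'a) r. (\<forall>(c, e)\<in>r. dist (p e) (g (p c)) < \<epsilon>) \<longrightarrow>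
    (\<forall>j\<le>m. \<forall>(c, e)\<in>r ^^ j. dist (p e) ((g ^^ j) (p c)) < \<eta>)"
  using assms(2)
proof (induction m arbitrary: \<eta>)
  case 0
  then show ?case by (intro exI[of _ 1]) auto
next
  case (Suc m)
  obtain \<rho> where \<rho>: "\<rho> > 0" "\<And>x y. dist x y < \<rho> \<Longrightarrow> dist (g x) (g y) < \<eta> / 2"
    using assms(1) Suc.prems unfolding uniformly_continuous_on_def
    by (metis UNIV_I half_gt_zero dist_commute)
  have "min \<rho> \<eta> > 0" using \<rho> Suc.prems by simp
  from Suc.IH[OF this] obtain \<epsilon> where \<epsilon>: "\<epsilon> > 0"
    and sh: "\<forall>(p :: 'c \<Rightarrow> 'a) r. (\<forall>(c, e)\<in>r. dist (p e) (g (p c)) < \<epsilon>) \<longrightarrow>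
      (\<forall>j\<le>m. \<forall>(c, e)\<in>r ^^ j. dist (p e) ((g ^^ j) (p c)) < min \<rho> \<eta>)"
    by (elim exE conjE)
  show ?case
  proof (intro exI[of _ "min \<epsilon> (\<eta> / 2)"] conjI allI impI)
    show "min \<epsilon> (\<eta> / 2) > 0" using \<epsilon> Suc.prems by simp
    fix p :: "'c \<Rightarrow> 'a" and r :: "('c \<times> 'c) set" and j
    assume r: "\<forall>(c, e)\<in>r. dist (p e) (g (p c)) < min \<epsilon> (\<eta> / 2)" and j: "j \<le> Suc m"
    from r have "\<forall>(c, e)\<in>r. dist (p e) (g (p c)) < \<epsilon>" by auto
    with sh have IH: "dist (p e) ((g ^^ i) (p c)) < min \<rho> \<eta>" if "i \<le> m" "(c, e) \<in> r ^^ i" for i c e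
      using that by fast
    have "dist (p e) ((g ^^ j) (p c)) < \<eta>" if ce: "(c, e) \<in> r ^^ j" for c e
    proof (cases "j \<le> m")
      case True
      with IH[OF this ce] show ?thesis by simp
    next
      case False
      with j have j: "j = Suc m" by simp
      with ce obtain d where d: "(c, d) \<in> r ^^ m" "(d, e) \<in> r" by auto
      have "dist (g (p d)) (g ((g ^^ m) (p c))) < \<eta> / 2"
        using IH[OF _ d(1)] by (intro \<rho>(2)) simp
      moreover have "dist (p e) (g (p d)) < \<eta> / 2" using r d(2) by auto
      ultimately show ?thesis
        unfolding j using dist_triangle[of "p e" "(g ^^ Suc m) (p c)" "g (p d)"] by simp
    qed
    then show "\<forall>(c, e)\<in>r ^^ j. dist (p e) ((g ^^ j) (p c)) < \<eta>" by auto
  qed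
qed

text \<open>In doubled coordinates this is the midpoint of the cell; neighbouring vertices are
  \<open>2 * \<delta>\<close> apart.\<close>

definition grid :: "real \<Rightarrow> ('n \<Rightarrow> int) \<Rightarrow> real ^ 'n" where
  "grid \<delta> c = (\<chi> i. \<delta> * real_of_int (c i))"

lemma dist_le_card_mult:
  fixes x y :: "real ^ 'n"
  assumes "\<And>i. \<bar>x $ i - y $ i\<bar> \<le> t"
  shows "dist x y \<le> real CARD('n) * t"
proof -
  have "dist x y \<le> (\<Sum>i\<in>UNIV. \<bar>x $ i - y $ i\<bar>)"
    using norm_le_l1_cart[of "x - y"] by (simp add: dist_norm)
  also have "\<dots> \<le> real CARD('n) * t"
    by (rule sum_bounded_above) (rule assms)
  finally show ?thesis .
qed

lemma finite_int_cube:
  "finite {c :: 'n::finite \<Rightarrow> int. \<forall>i. l i \<le> c i \<and> c i \<le> u i}"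
proof -
  have "finite (PiE UNIV (\<lambda>i::'n. {l i..u i}))" by (rule finite_PiE) auto
  then show ?thesis by (simp add: PiE_UNIV_domain Pi_def)
qed

lemma finite_block: "finite (block a b :: ('n::finite \<Rightarrow> int) set)"
  unfolding block_def by (rule finite_int_cube)

text \<open>The carrier of a cell is the smallest block around the rounded images of the midpoints
  of all its faces. A face has fewer faces to enclose, which gives monotonicity.\<close>

lemma grid_carrier:
  fixes g :: "real ^ 'n \<Rightarrow> real ^ 'n"
  assumes "uniformly_continuous_on UNIV g" "\<epsilon> > 0"
  shows "\<exists>\<delta> lo hi. 0 < \<delta> \<and> \<delta> \<le> 1 / 4 \<and> (\<forall>c i. lo c i \<le> hi c i) \<and>
    (\<forall>c d i. d \<in> Poly_Mapping.keys (bd (gen c)) \<longrightarrow> lo c i \<le> lo d i \<and> hi d i \<le> hi c i) \<and>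
    (\<forall>c. \<forall>e\<in>block (lo c) (hi c). dist (grid \<delta> e) (g (grid \<delta> c)) < \<epsilon>)"
proof -
  define n where "n = real CARD('n)"
  have n: "n > 0" by (simp add: n_def)
  \<comment> \<open>Each coordinate will be off by at most \<open>3 * t\<close>: \<open>t\<close>
    from the variation of \<open>g\<close> over a cell and \<open>2 * \<delta>\<close> from
    rounding. Over \<open>n\<close> coordinates this makes three quarters of
    \<open>\<epsilon>\<close>.\<close>
  define t where "t = \<epsilon> / (4 * n)"
  have t: "t > 0" using n assms(2) by (simp add: t_def)
  obtain \<rho> where \<rho>: "\<rho> > 0" "\<And>x y. dist x y < \<rho> \<Longrightarrow> dist (g x) (g y) < t"
    using assms(1) t unfolding uniformly_continuous_on_def
    by (metis UNIV_I dist_commute)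
  define \<delta> where "\<delta> = min (1 / 4) (min t (\<rho> / (2 * n)))"
  have \<delta>: "\<delta> > 0" "\<delta> \<le> 1 / 4" "\<delta> \<le> t" "\<delta> \<le> \<rho> / (2 * n)" using t \<rho> n by (auto simp: \<delta>_def)
  \<comment> \<open>The faces of \<open>c\<close>, with \<open>c\<close> itself: an edge coordinate
    may move to either end, a vertex coordinate stays.\<close>
  define nb where "nb c = {d :: 'n \<Rightarrow> int. \<forall>i. d i = c i \<or> odd (c i) \<and> \<bar>d i - c i\<bar> \<le> 1}" for c
  have nb_near: "\<bar>d i - c i\<bar> \<le> 1" if "d \<in> nb c" for c d i
  proof -
    have "d i = c i \<or> odd (c i) \<and> \<bar>d i - c i\<bar> \<le> 1" using that by (simp add: nb_def)
    then show ?thesis by auto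
  qed
  have nb_fin: "finite (nb c)" for c
  proof (rule finite_subset[OF _ finite_int_cube[of "\<lambda>i. c i - 1" "\<lambda>i. c i + 1"]])
    show "nb c \<subseteq> {d. \<forall>i. c i - 1 \<le> d i \<and> d i \<le> c i + 1}"
    proof (intro subsetI CollectI allI)
      fix d i assume "d \<in> nb c"
      then show "c i - 1 \<le> d i \<and> d i \<le> c i + 1" using nb_near[of d c i] by linarith
    qed
  qed
  have nb_self: "c \<in> nb c" for c by (simp add: nb_def)
  have nb_face: "nb d \<subseteq> nb c" if d: "d \<in> Poly_Mapping.keys (bd (gen c))" for c d
  proof -
    obtain i where i: "odd (c i)" "d = c(i := c i - 1) \<or> d = c(i := c i + 1)"
      using face_cases[OF d] by metis
    show ?thesis
    proof
      fix e assume e: "e \<in> nb d"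
      have "e j = c j \<or> odd (c j) \<and> \<bar>e j - c j\<bar> \<le> 1" for j
      proof (cases "j = i")
        case True
        moreover have "even (d i)" using i by auto
        ultimately have "e i = d i" using e by (auto simp: nb_def)
        then show ?thesis using True i by auto
      next
        case False
        then have "d j = c j" using i(2) by auto
        moreover have "e j = d j \<or> odd (d j) \<and> \<bar>e j - d j\<bar> \<le> 1"
          using e by (simp add: nb_def)
        ultimately show ?thesis by simp
      qed
      then show "e \<in> nb c" by (simp add: nb_def)
    qed
  qed
  define q where "q d i = \<lfloor>g (grid \<delta> d) $ i / (2 * \<delta>)\<rfloor>" for d i
  define lo where "lo c i = Min ((\<lambda>d. q d i) ` nb c)" for c i
  define hi where "hi c i = Max ((\<lambda>d. q d i) ` nb c)" for c i
  have "lo c i \<le> hi c i" for c i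
  proof -
    have "lo c i \<le> q c i" "q c i \<le> hi c i"
      unfolding lo_def hi_def using nb_fin nb_self by (auto intro!: Min_le Max_ge)
    then show ?thesis by simp
  qed
  moreover have "lo c i \<le> lo d i \<and> hi d i \<le> hi c i" if "d \<in> Poly_Mapping.keys (bd (gen c))" for c d i
    unfolding lo_def hi_def using nb_face[OF that] nb_fin nb_self[of d]
    by (intro conjI Min_antimono Max_mono image_mono) auto
  moreover have "dist (grid \<delta> e) (g (grid \<delta> c)) < \<epsilon>" if e: "e \<in> block (lo c) (hi c)" for c e
  proof -
    have near: "\<bar>g (grid \<delta> d) $ i - g (grid \<delta> c) $ i\<bar> < t" if "d \<in> nb c" for d i
    proof -
      have "\<bar>real_of_int (d j - c j)\<bar> \<le> 1" for j using nb_near[OF that, of j] by linarith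
      then have "\<delta> * \<bar>real_of_int (d j - c j)\<bar> \<le> \<delta> * 1" for j
        using \<delta>(1) by (intro mult_left_mono) auto
      then have "\<bar>grid \<delta> d $ j - grid \<delta> c $ j\<bar> \<le> \<delta>" for j
        using \<delta>(1) by (simp add: grid_def abs_mult flip: right_diff_distrib)
      then have "dist (grid \<delta> d) (grid \<delta> c) \<le> n * \<delta>"
        unfolding n_def by (rule dist_le_card_mult)
      also have "n * \<delta> \<le> n * (\<rho> / (2 * n))" using n \<delta>(4) by (intro mult_left_mono) auto
      also have "\<dots> < \<rho>" using n \<rho>(1) by simp
      finally have "dist (g (grid \<delta> d)) (g (grid \<delta> c)) < t" by (rule \<rho>(2))
      moreover have "\<bar>g (grid \<delta> d) $ i - g (grid \<delta> c) $ i\<bar> \<le> dist (g (grid \<delta> d)) (g (grid \<delta> c))"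
        using component_le_norm_cart[of "g (grid \<delta> d) - g (grid \<delta> c)" i] by (simp add: dist_norm)
      ultimately show ?thesis by simp
    qed
    have "\<bar>grid \<delta> e $ i - g (grid \<delta> c) $ i\<bar> \<le> 3 * t" for i
    proof -
      have ne: "(\<lambda>d. q d i) ` nb c \<noteq> {}" using nb_self by auto
      have "lo c i \<in> (\<lambda>d. q d i) ` nb c" "hi c i \<in> (\<lambda>d. q d i) ` nb c"
        unfolding lo_def hi_def using nb_fin ne by (auto intro!: Min_in Max_in)
      then obtain d d' where d: "d \<in> nb c" "lo c i = q d i" and d': "d' \<in> nb c" "hi c i = q d' i"
        by auto
      have bounds: "2 * q d i \<le> e i" "e i \<le> 2 * q d' i"
        using e by (auto simp: block_def simp flip: d(2) d'(2))
      have q_le: "2 * \<delta> * real_of_int (q x i) \<le> g (grid \<delta> x) $ i" for x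
      proof -
        have "real_of_int (q x i) \<le> g (grid \<delta> x) $ i / (2 * \<delta>)" by (simp add: q_def)
        then show ?thesis using \<delta>(1) by (simp add: field_simps)
      qed
      have q_ge: "g (grid \<delta> x) $ i \<le> 2 * \<delta> * real_of_int (q x i) + 2 * \<delta>" for x
      proof -
        have "g (grid \<delta> x) $ i / (2 * \<delta>) \<le> real_of_int (q x i) + 1" unfolding q_def by linarith
        then show ?thesis using \<delta>(1) by (simp add: field_simps)
      qed
      have "\<delta> * real_of_int (2 * q d i) \<le> \<delta> * real_of_int (e i)"
        "\<delta> * real_of_int (e i) \<le> \<delta> * real_of_int (2 * q d' i)"
        using bounds \<delta>(1) by (intro mult_left_mono; simp only: of_int_le_iff; simp)+
      then have "2 * \<delta> * real_of_int (q d i) \<le> grid \<delta> e $ i"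
        "grid \<delta> e $ i \<le> 2 * \<delta> * real_of_int (q d' i)"
        by (simp_all add: grid_def mult_ac)
      then show ?thesis
        using q_le[of d'] q_ge[of d] near[OF d(1), of i] near[OF d'(1), of i] \<delta>(3) t by linarith
    qed
    then have "dist (grid \<delta> e) (g (grid \<delta> c)) \<le> n * (3 * t)"
      unfolding n_def by (rule dist_le_card_mult)
    also have "\<dots> < \<epsilon>" using n assms(2) by (simp add: t_def)
    finally show ?thesis .
  qed
  ultimately show ?thesis
    using \<delta>(1,2) by (intro exI[of _ \<delta>] exI[of _ lo] exI[of _ hi]) simp
qed

section \<open>Fixed points of maps that absorb a cube\<close>

definition cube :: "real \<Rightarrow> (real ^ 'n) set" where
  "cube R = cbox (\<chi> i. - R) (\<chi> i. R)"

lemma mem_cube: "x \<in> cube R \<longleftrightarrow> (\<forall>i. \<bar>x $ i\<bar> \<le> R)"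
  by (auto simp: cube_def mem_box_cart abs_le_iff minus_le_iff)

text \<open>The margin 1 between the two cubes is spent in halves: one on the shadowing error, one
  on rounding the cube to a block, where \<open>2 * \<delta> \<le> 1 / 2\<close> is used.\<close>

lemma approx_fixed_point:
  fixes g :: "real ^ 'n \<Rightarrow> real ^ 'n"
  assumes uc: "uniformly_continuous_on UNIV g" and R: "R \<ge> 1"
    and absorb: "\<And>x j. x \<in> cube R \<Longrightarrow> j \<ge> M \<Longrightarrow> (g ^^ j) x \<in> cube (R - 1)"
    and "\<epsilon> > 0"
  shows "\<exists>x\<in>cube R. dist (g x) x < \<epsilon>"
proof -
  have "(0 :: real) < 1 / 2" by simp
  \<comment> \<open>Shadowing covers bounded times only. Times from \<open>Suc M\<close> to
    \<open>2 * Suc M\<close> suffice, because a longer path can be cut after \<open>Suc M\<close>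
    steps, a positive number even if \<open>M\<close> is 0, with at least \<open>Suc M\<close> steps
    remaining.\<close>
  from shadowing[OF uc this, of "2 * Suc M"] obtain \<epsilon>' where \<epsilon>': "\<epsilon>' > 0"
    and shadow: "\<forall>(p :: ('n \<Rightarrow> int) \<Rightarrow> real ^ 'n) r. (\<forall>(c, e)\<in>r. dist (p e) (g (p c)) < \<epsilon>') \<longrightarrow>
      (\<forall>j\<le>2 * Suc M. \<forall>(c, e)\<in>r ^^ j. dist (p e) ((g ^^ j) (p c)) < 1 / 2)"
    by (elim exE conjE)
  have "min \<epsilon> \<epsilon>' > 0" using \<epsilon>' \<open>\<epsilon> > 0\<close> by simp
  from grid_carrier[OF uc this] obtain \<delta> lo hi where \<delta>: "0 < \<delta>" "\<delta> \<le> 1 / 4"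
    and le: "\<forall>c i. lo c i \<le> hi c i"
    and mono: "\<forall>c d i. d \<in> Poly_Mapping.keys (bd (gen c)) \<longrightarrow> lo c i \<le> lo d i \<and> hi d i \<le> hi c i"
    and close: "\<forall>c. \<forall>e\<in>block (lo c) (hi c). dist (grid \<delta> e) (g (grid \<delta> c)) < min \<epsilon> \<epsilon>'"
    by (elim exE conjE)
  define r where "r = {(c, e). e \<in> block (lo c) (hi c)}"
  have r_close: "dist (grid \<delta> e) (g (grid \<delta> c)) < min \<epsilon> \<epsilon>'" if "(c, e) \<in> r" for c e
    using close that by (simp add: r_def)
  have shadow_r: "dist (grid \<delta> e) ((g ^^ j) (grid \<delta> c)) < 1 / 2"
    if "j \<le> 2 * Suc M" "(c, e) \<in> r ^^ j" for j c e
    using shadow[rule_format, of r "grid \<delta>" j "(c, e)"] r_close that by fastforce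
  \<comment> \<open>\<open>Y\<close> becomes the largest symmetric block whose grid points lie in
    \<open>cube R\<close>.\<close>
  define L where "L = \<lfloor>R / (2 * \<delta>)\<rfloor>"
  define Y where "Y = block (\<lambda>_ :: 'n. - L) (\<lambda>_. L)"
  have "real_of_int L \<le> R / (2 * \<delta>)" by (simp add: L_def)
  then have L_le: "\<delta> * (2 * real_of_int L) \<le> R" using \<delta>(1) by (simp add: field_simps)
  have "R / (2 * \<delta>) \<le> real_of_int L + 1" unfolding L_def by linarith
  then have "R \<le> \<delta> * (2 * real_of_int L) + 2 * \<delta>" using \<delta>(1) by (simp add: field_simps)
  then have L_ge: "R - 1 / 2 \<le> \<delta> * (2 * real_of_int L)" using \<delta>(2) by linarith
  have L0: "0 \<le> L" using R \<delta>(1) by (simp add: L_def)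
  have grid_abs: "\<bar>grid \<delta> c $ i\<bar> = \<delta> * \<bar>real_of_int (c i)\<bar>" for c :: "'n \<Rightarrow> int" and i
    using \<delta>(1) by (simp add: grid_def abs_mult)
  have Y_cube: "grid \<delta> c \<in> cube R" if c: "c \<in> Y" for c
    unfolding mem_cube
  proof
    fix i
    have "2 * (- L) \<le> c i" "c i \<le> 2 * L" using c unfolding Y_def block_def by blast+
    then have "\<bar>real_of_int (c i)\<bar> \<le> 2 * real_of_int L" by linarith
    then have "\<delta> * \<bar>real_of_int (c i)\<bar> \<le> \<delta> * (2 * real_of_int L)"
      using \<delta>(1) by (intro mult_left_mono) auto
    with L_le show "\<bar>grid \<delta> c $ i\<bar> \<le> R" unfolding grid_abs by linarith
  qed
  have cube_Y: "c \<in> Y" if c: "\<And>i. \<bar>grid \<delta> c $ i\<bar> \<le> R - 1 / 2" for c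
    unfolding Y_def block_def
  proof (intro CollectI allI)
    fix i
    have "\<delta> * \<bar>real_of_int (c i)\<bar> \<le> \<delta> * (2 * real_of_int L)"
      using c[of i] L_ge unfolding grid_abs by linarith
    then have "\<bar>real_of_int (c i)\<bar> \<le> 2 * real_of_int L" using \<delta>(1) by simp
    then show "2 * - L \<le> c i \<and> c i \<le> 2 * L" by linarith
  qed
  have short: "e \<in> Y" if "c \<in> Y" "(c, e) \<in> r ^^ j" "Suc M \<le> j" "j \<le> 2 * Suc M" for c e j
  proof (rule cube_Y)
    fix i
    have "\<bar>(g ^^ j) (grid \<delta> c) $ i\<bar> \<le> R - 1"
      using absorb[OF Y_cube[OF that(1)], of j] that(3) by (simp add: mem_cube)
    moreover have "\<bar>(grid \<delta> e - (g ^^ j) (grid \<delta> c)) $ i\<bar> \<le> 1 / 2"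
      using shadow_r[OF that(4,2)] component_le_norm_cart[of "grid \<delta> e - (g ^^ j) (grid \<delta> c)" i]
      by (simp add: dist_norm)
    ultimately show "\<bar>grid \<delta> e $ i\<bar> \<le> R - 1 / 2" unfolding vector_minus_component by linarith
  qed
  have long: "e \<in> Y" if "c \<in> Y" "(c, e) \<in> r ^^ j" "Suc M \<le> j" for c e j
    using that
  proof (induction j arbitrary: c rule: less_induct)
    case (less j)
    show ?case
    proof (cases "j \<le> 2 * Suc M")
      case True
      with short less.prems show ?thesis by blast
    next
      case False
      then have "j = Suc M + (j - Suc M)" by simp
      with less.prems(2) have "(c, e) \<in> r ^^ Suc M O r ^^ (j - Suc M)"
        by (metis relpow_add)
      then obtain d where d: "(c, d) \<in> r ^^ Suc M" "(d, e) \<in> r ^^ (j - Suc M)" by blast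
      have "d \<in> Y" by (rule short[OF less.prems(1) d(1)]) auto
      from less.IH[OF _ this d(2)] False show ?thesis by simp
    qed
  qed
  \<comment> \<open>\<open>X\<close> is finite, because a path of length greater than \<open>M\<close> that starts in \<open>Y\<close> ends in \<open>Y\<close>.\<close>
  define X where "X = r\<^sup>* `` Y"
  have r_fin: "finite (r `` S)" if "finite S" for S
  proof -
    have "r `` S = (\<Union>c\<in>S. block (lo c) (hi c))" by (auto simp: r_def)
    then show ?thesis using that by (simp add: finite_block)
  qed
  have pow_fin: "finite ((r ^^ j) `` Y)" for j
  proof (induction j)
    case 0
    show ?case by (simp add: Y_def finite_block)
  next
    case (Suc j)
    then show ?case by (simp add: relcomp_Image r_fin)
  qed
  have "X \<subseteq> Y \<union> (\<Union>j<Suc M. (r ^^ j) `` Y)"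
  proof
    fix e assume "e \<in> X"
    then obtain c j where cj: "c \<in> Y" "(c, e) \<in> r ^^ j"
      unfolding X_def using rtrancl_imp_relpow by blast
    then show "e \<in> Y \<union> (\<Union>j<Suc M. (r ^^ j) `` Y)"
      using long[OF cj] by (cases "Suc M \<le> j") auto
  qed
  then have X_fin: "finite X"
    by (rule finite_subset) (use pow_fin in \<open>auto simp: Y_def finite_block\<close>)
  have XY: "Y \<subseteq> X" by (auto simp: X_def)
  have rX: "r `` X \<subseteq> X" unfolding X_def by (auto intro: rtrancl_into_rtrancl)
  \<comment> \<open>Every exponent above \<open>M\<close> would do here; the trace identity asks for
    a power of two.\<close>
  have powX: "(r ^^ (2 ^ Suc M)) `` X \<subseteq> Y"
  proof
    fix e assume "e \<in> (r ^^ (2 ^ Suc M)) `` X"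
    then obtain d where "d \<in> X" and de: "(d, e) \<in> r ^^ (2 ^ Suc M)" by blast
    then obtain c j where c: "c \<in> Y" "(c, d) \<in> r ^^ j"
      unfolding X_def using rtrancl_imp_relpow by blast
    have "(c, e) \<in> r ^^ (j + 2 ^ Suc M)" using c(2) de by (auto simp: relpow_add)
    moreover have "Suc M \<le> j + 2 ^ Suc M"
      using less_exp[of "Suc M"] by (meson less_imp_le trans_le_add2)
    ultimately show "e \<in> Y" by (rule long[OF c(1)])
  qed
  obtain c where c: "c \<in> X" "(c, c) \<in> r"
  proof (rule fixed_cell[of lo hi "\<lambda>_. - L" "\<lambda>_. L" X "Suc M"])
    fix c assume "c \<in> X" "(c, c) \<in> {(c, e). e \<in> block (lo c) (hi c)}"
    then show thesis by (intro that) (simp_all add: r_def)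
  qed (use le mono L0 X_fin XY rX powX in \<open>simp_all add: Y_def flip: r_def\<close>)
  \<comment> \<open>\<open>X\<close> may reach outside \<open>cube R\<close>, but going round the
    loop at \<open>c\<close> often enough ends in \<open>Y\<close>.\<close>
  have "(c, c) \<in> r ^^ n" for n by (induction n) (use c(2) in auto)
  with powX c(1) have "c \<in> Y" by blast
  with Y_cube r_close[OF c(2)] show ?thesis
    by (metis dist_commute min_less_iff_conj)
qed

lemma fixed_point_of_absorbed:
  fixes g :: "real ^ 'n \<Rightarrow> real ^ 'n"
  assumes uc: "uniformly_continuous_on UNIV g" and R: "R \<ge> 1"
    and absorb: "\<And>x j. x \<in> cube R \<Longrightarrow> j \<ge> M \<Longrightarrow> (g ^^ j) x \<in> cube (R - 1)"
  shows "\<exists>x\<in>cube R. g x = x"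
proof -
  have "continuous_on (cube R) (\<lambda>x. dist (g x) x)"
    by (intro continuous_intros continuous_on_subset[OF uniformly_continuous_imp_continuous[OF uc]]) simp
  moreover have "compact (cube R :: (real ^ 'n) set)" by (simp add: cube_def)
  moreover have "(0 :: real ^ 'n) \<in> cube R" using R by (simp add: mem_cube)
  ultimately obtain x where x: "x \<in> cube R" "\<forall>y\<in>cube R. dist (g x) x \<le> dist (g y) y"
    using continuous_attains_inf[of "cube R" "\<lambda>x. dist (g x) x"] by blast
  have "g x = x"
  proof (rule ccontr)
    assume "g x \<noteq> x"
    then have "dist (g x) x > 0" by simp
    from approx_fixed_point[OF uc R absorb this] x(2) show False by force
  qed
  with x show ?thesis by blast
qed

section \<open>Windows\<close>

lemma continuous_on_funpow:
  fixes f :: "'a::topological_space \<Rightarrow> 'a"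
  assumes "continuous_on UNIV f"
  shows "continuous_on S (f ^^ k)"
  by (induction k)
    (auto intro: continuous_on_compose2[OF assms] continuous_on_id simp: id_def o_def)

text \<open>The preimages of \<open>B\<close> under the iterates form an open cover. Openness is why
  a ball around the window is used in place of the window.\<close>

lemma compact_hitting_time:
  fixes f :: "'a::topological_space \<Rightarrow> 'a"
  assumes "continuous_on UNIV f" "compact S" "open B" "\<And>x. x \<in> S \<Longrightarrow> \<exists>k. (f ^^ k) x \<in> B"
  shows "\<exists>N. \<forall>x\<in>S. \<exists>k\<le>N. (f ^^ k) x \<in> B"
proof -
  have "open ((f ^^ k) -` B)" for k
    by (rule open_vimage[OF assms(3) continuous_on_funpow[OF assms(1)]])
  moreover have "S \<subseteq> (\<Union>k\<in>UNIV. (f ^^ k) -` B)" using assms(4) by auto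
  ultimately obtain C where C: "finite C" "S \<subseteq> (\<Union>k\<in>C. (f ^^ k) -` B)"
    by (meson compactE_image[OF assms(2)])
  show ?thesis
  proof (rule exI[of _ "Max C"], rule ballI)
    fix x assume "x \<in> S"
    then obtain k where "k \<in> C" "(f ^^ k) x \<in> B" using C(2) by auto
    then show "\<exists>k\<le>Max C. (f ^^ k) x \<in> B"
      using C(1) by (intro exI[of _ k]) auto
  qed
qed

text \<open>Compactness makes hitting times uniform twice: from the image of \<open>?S\<close>, to
  confine all orbits that start in the ball to \<open>K\<close>, and from \<open>cube R\<close>, to
  make them enter \<open>K\<close> for good by time \<open>M\<close>.\<close>

theorem map_window_fixed_point:
  fixes f :: "real ^ 'n \<Rightarrow> real ^ 'n"
  assumes f: "continuous_on UNIV f" and W: "window (map_forward_orbit f) W"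
  shows "\<exists>p\<in>W. f p = p"
proof -
  have "bounded W" using W by (simp add: window_def compact_imp_bounded)
  then obtain s where "W \<subseteq> ball 0 s" using bounded_subset_ballD by blast
  with W have hit: "\<exists>k. (f ^^ k) x \<in> ball 0 s" for x
    unfolding window_def map_forward_orbit_def by fastforce
  have return: "\<exists>k. (f ^^ Suc k) x \<in> ball 0 s" for x
    using hit[of "f x"] by (simp add: funpow_swap1)
  let ?S = "cball (0 :: real ^ 'n) s"
  have "compact (f ` ?S)"
    by (intro compact_continuous_image continuous_on_subset[OF f]) auto
  then obtain N where N: "\<forall>y\<in>f ` ?S. \<exists>k\<le>N. (f ^^ k) y \<in> ball 0 s"
    using compact_hitting_time[OF f _ open_ball hit] by blast
  define K where "K = (\<Union>k\<le>N. (f ^^ k) ` ?S)"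
  have in_K: "(f ^^ j) x \<in> K" if "x \<in> ?S" for x j
    using that
  proof (induction j arbitrary: x rule: less_induct)
    case (less j)
    show ?case
    proof (cases "j \<le> N")
      case True
      then show ?thesis unfolding K_def using less.prems by (intro UN_I[of j] imageI) auto
    next
      case False
      \<comment> \<open>The return time is counted from \<open>f x\<close>, so at least one step is
        used up and the induction descends.\<close>
      obtain k where k: "k \<le> N" "(f ^^ k) (f x) \<in> ball 0 s"
        using N less.prems by blast
      have "(f ^^ (j - Suc k)) ((f ^^ k) (f x)) \<in> K"
        by (rule less.IH) (use k False in auto)
      moreover have "(f ^^ (j - Suc k)) ((f ^^ k) (f x)) = (f ^^ ((j - Suc k) + Suc k)) x"
        by (simp only: funpow_add o_apply funpow_Suc_right)
      ultimately show ?thesis using k(1) False by simp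
    qed
  qed
  have "compact K"
    unfolding K_def by (intro compact_UN compact_continuous_image continuous_on_funpow f) auto
  then obtain b where b: "b > 0" "\<forall>x\<in>K. norm x \<le> b"
    using compact_imp_bounded bounded_pos by metis
  define R where "R = b + 1"
  have K_cube: "K \<subseteq> cube (R - 1)"
  proof
    fix x assume "x \<in> K"
    then have "norm x \<le> b" using b(2) by blast
    then show "x \<in> cube (R - 1)"
      using order_trans[OF component_le_norm_cart] by (auto simp: mem_cube R_def)
  qed
  have "compact (cube R :: (real ^ 'n) set)" by (simp add: cube_def)
  then obtain M where M: "\<forall>x\<in>cube R. \<exists>k\<le>M. (f ^^ k) x \<in> ball 0 s"
    using compact_hitting_time[OF f _ open_ball hit] by blast
  have absorb: "(f ^^ j) x \<in> cube (R - 1)" if x: "x \<in> cube R" and j: "j \<ge> M" for x j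
  proof -
    obtain k where k: "k \<le> M" "(f ^^ k) x \<in> ball 0 s" using M x by blast
    have "(f ^^ (j - k)) ((f ^^ k) x) \<in> K" by (rule in_K) (use k(2) in auto)
    moreover have "(f ^^ (j - k)) ((f ^^ k) x) = (f ^^ ((j - k) + k)) x"
      by (simp only: funpow_add o_apply)
    ultimately show ?thesis using K_cube k(1) j by auto
  qed
  have "compact (\<Union>j\<le>M. (f ^^ j) ` (cube R :: (real ^ 'n) set))"
    by (intro compact_UN compact_continuous_image continuous_on_funpow f) (auto simp: cube_def)
  then obtain b' where b': "b' > 0" "\<forall>x\<in>(\<Union>j\<le>M. (f ^^ j) ` cube R). norm x \<le> b'"
    using compact_imp_bounded bounded_pos by metis
  \<comment> \<open>Before time \<open>M\<close> an orbit from \<open>cube R\<close> may leave that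
    cube; the clamp below must not alter this transient part.\<close>
  define R' where "R' = max b' R"
  have orbit: "(f ^^ j) x \<in> cube R'" if x: "x \<in> cube R" for x j
  proof (cases "j \<le> M")
    case True
    then have "norm ((f ^^ j) x) \<le> b'" using b'(2) x by blast
    then have "norm ((f ^^ j) x) \<le> R'" by (simp add: R'_def)
    then show ?thesis
      unfolding mem_cube by (intro allI order_trans[OF component_le_norm_cart])
  next
    case False
    then have "(f ^^ j) x \<in> cube (R - 1)" using absorb x by simp
    then have "\<bar>(f ^^ j) x $ i\<bar> \<le> R - 1" for i by (simp add: mem_cube)
    moreover have "R - 1 \<le> R'" by (simp add: R'_def)
    ultimately show ?thesis unfolding mem_cube by (auto intro: order_trans)
  qed
  \<comment> \<open>Composing with a clamp makes the map uniformly continuous without changing orbits from \<open>cube R\<close>.\<close>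
  let ?clamp = "clamp (\<chi> i. - R') (\<chi> i. R') :: real ^ 'n \<Rightarrow> _"
  define g where "g = f \<circ> ?clamp"
  have "0 \<le> R'" using b' by (simp add: R'_def)
  then have "?clamp x \<in> cbox (\<chi> i. - R') (\<chi> i. R')" for x
    by (intro clamp_in_interval) (auto simp: Basis_vec_def inner_axis)
  then have clamp_in: "?clamp ` UNIV \<subseteq> cube R'" by (auto simp: cube_def)
  have "uniformly_continuous_on UNIV ?clamp"
    unfolding uniformly_continuous_on_def
    by (metis dist_clamps_le_dist_args le_less_trans)
  moreover have "uniformly_continuous_on (cube R') f"
    by (intro compact_uniformly_continuous continuous_on_subset[OF f]) (auto simp: cube_def)
  then have "uniformly_continuous_on (?clamp ` UNIV) f"
    using clamp_in unfolding uniformly_continuous_on_def by (meson subsetD)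
  ultimately have uc: "uniformly_continuous_on UNIV g"
    unfolding g_def o_def by (rule uniformly_continuous_on_compose)
  have gf: "g y = f y" if "y \<in> cube R'" for y
    using that by (simp add: g_def cube_def)
  have "(g ^^ j) x = (f ^^ j) x" if "x \<in> cube R" for x j
    by (induction j) (simp_all add: gf orbit[OF that])
  then have "\<exists>p\<in>cube R. g p = p"
    using absorb b(1) by (intro fixed_point_of_absorbed[OF uc, of R M]) (auto simp: R_def)
  then obtain p where p: "p \<in> cube R" "g p = p" by blast
  then have fp: "f p = p" using gf[of p] orbit[of p 0] by simp
  \<comment> \<open>The fixed point was found in a cube only; its orbit is one point and must meet
    \<open>W\<close>.\<close>
  have "(f ^^ k) p = p" for k by (induction k) (simp_all add: fp)
  then have "map_forward_orbit f p = {p}" by (auto simp: map_forward_orbit_def)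
  with W have "p \<in> W" unfolding window_def by (metis disjoint_insert(1) inf_bot_left inf_commute)
  with fp show ?thesis by blast
qed

theorem flow_window_fixed_point:
  fixes \<phi> :: "real \<Rightarrow> real ^ 'n \<Rightarrow> real ^ 'n"
  assumes flow: "continuous_flow \<phi>" and W: "window (flow_forward_orbit \<phi>) W"
  shows "\<exists>p\<in>W. \<forall>t. \<phi> t p = p"
proof -
  have cont: "continuous_on UNIV (\<lambda>(t, x). \<phi> t x)"
    and zero: "\<And>x. \<phi> 0 x = x" and add: "\<And>s t x. \<phi> (s + t) x = \<phi> s (\<phi> t x)"
    using flow by (auto simp: continuous_flow_def)
  have cont_t: "continuous_on UNIV (\<phi> t)" for t
    using continuous_on_compose2[OF cont, of UNIV "\<lambda>x. (t, x)"]
    by (simp add: continuous_on_Pair continuous_on_const continuous_on_id)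
  \<comment> \<open>The orbit of a time \<open>s\<close> map can step over \<open>W\<close>. If
    \<open>s \<le> 1\<close>, its first sample after a visit to \<open>W\<close> comes at most time
    1 later and so lies in \<open>V\<close>, a compact set that does not depend on
    \<open>s\<close>.\<close>
  define V where "V = (\<lambda>(t, x). \<phi> t x) ` ({0..1} \<times> W)"
  have "compact W" using W by (simp add: window_def)
  then have V: "compact V"
    unfolding V_def
    by (intro compact_continuous_image continuous_on_subset[OF cont] compact_Times) auto
  have pow: "(\<phi> s ^^ k) x = \<phi> (real k * s) x" for s k x
    by (induction k) (simp_all add: zero algebra_simps flip: add)
  have win: "window (map_forward_orbit (\<phi> s)) V" if s: "0 < s" "s \<le> 1" for s
    unfolding window_def
  proof (intro conjI V allI)
    fix x
    obtain t where t: "t \<ge> 0" "\<phi> t x \<in> W"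
      using W unfolding window_def flow_forward_orbit_def by blast
    define k where "k = nat \<lceil>t / s\<rceil>"
    have "t / s \<le> real k" "real k \<le> t / s + 1"
      using divide_nonneg_pos[OF t(1) s(1)] unfolding k_def by linarith+
    then have k: "t \<le> real k * s" "real k * s \<le> t + s" using s(1) by (auto simp: field_simps)
    have "\<phi> (real k * s) x = \<phi> (real k * s - t) (\<phi> t x)"
      by (simp flip: add)
    also have "\<dots> \<in> V" unfolding V_def using k s(2) t(2) by force
    finally show "map_forward_orbit (\<phi> s) x \<inter> V \<noteq> {}"
      unfolding map_forward_orbit_def by (auto simp flip: pow)
  qed
  have "\<exists>p\<in>V. \<phi> (1 / real (Suc k)) p = p" for k
    by (intro map_window_fixed_point cont_t win) auto
  then obtain p where p: "\<And>k. p k \<in> V" "\<And>k. \<phi> (1 / real (Suc k)) (p k) = p k" by metis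
  from V p(1) obtain l \<sigma> where l: "l \<in> V" "strict_mono \<sigma>" "(p \<circ> \<sigma>) \<longlonglongrightarrow> l"
    unfolding compact_def by metis
  have fixed: "\<phi> (real_of_int m * (1 / real (Suc k))) (p k) = p k" for m k
  proof -
    have nonneg: "\<phi> (real j * (1 / real (Suc k))) (p k) = p k" for j
      unfolding pow[symmetric] by (induction j) (simp_all add: p(2) del: of_nat_Suc)
    show ?thesis
    proof (cases "m \<ge> 0")
      case True
      then show ?thesis using nonneg[of "nat m"] by simp
    next
      case False
      \<comment> \<open>A negative multiple is undone by the opposite positive one, which already
        fixes \<open>p k\<close>.\<close>
      then have "real_of_int m * (1 / real (Suc k)) + real (nat (- m)) * (1 / real (Suc k)) = 0"
        by simp
      then show ?thesis
        using nonneg[of "nat (- m)"] zero[of "p k"] by (metis add)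
    qed
  qed
  have l_fixed: "\<phi> t l = l" for t
  proof -
    \<comment> \<open>The largest multiple of \<open>1 / real (Suc k)\<close> not above
      \<open>t\<close>: it fixes \<open>p k\<close>, and it tends to \<open>t\<close>, so joint
      continuity of the flow passes the equation to the limit.\<close>
    define \<tau> where "\<tau> k = real_of_int \<lfloor>t * real (Suc k)\<rfloor> * (1 / real (Suc k))" for k
    have "\<tau> \<longlonglongrightarrow> t"
    proof (rule tendsto_sandwich)
      show "(\<lambda>k. t - 1 / real (Suc k)) \<longlonglongrightarrow> t"
        using tendsto_diff[OF tendsto_const[of t] LIMSEQ_Suc[OF lim_1_over_n]] by simp
      have "t - 1 / real (Suc k) \<le> \<tau> k" for k
      proof -
        have "(t * real (Suc k) - 1) / real (Suc k) \<le> \<lfloor>t * real (Suc k)\<rfloor> / real (Suc k)"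
          by (rule divide_right_mono) linarith+
        then show ?thesis by (simp add: \<tau>_def diff_divide_distrib del: of_nat_Suc)
      qed
      then show "\<forall>\<^sub>F k in sequentially. t - 1 / real (Suc k) \<le> \<tau> k" by simp
      have "\<tau> k \<le> t" for k
      proof -
        have "\<lfloor>t * real (Suc k)\<rfloor> / real (Suc k) \<le> (t * real (Suc k)) / real (Suc k)"
          by (rule divide_right_mono) linarith+
        then show ?thesis by (simp add: \<tau>_def del: of_nat_Suc)
      qed
      then show "\<forall>\<^sub>F k in sequentially. \<tau> k \<le> t" by simp
    qed auto
    then have "(\<lambda>k. (\<tau> (\<sigma> k), p (\<sigma> k))) \<longlonglongrightarrow> (t, l)"
      using l(2,3) by (intro tendsto_Pair) (auto simp: o_def dest: LIMSEQ_subseq_LIMSEQ)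
    then have "(\<lambda>k. \<phi> (\<tau> (\<sigma> k)) (p (\<sigma> k))) \<longlonglongrightarrow> \<phi> t l"
      using continuous_on_tendsto_compose[OF cont] by fastforce
    moreover have "\<phi> (\<tau> (\<sigma> k)) (p (\<sigma> k)) = p (\<sigma> k)" for k
      unfolding \<tau>_def by (rule fixed)
    ultimately show ?thesis using l(3) LIMSEQ_unique by (fastforce simp: o_def)
  qed
  then have "flow_forward_orbit \<phi> l = {l}" by (auto simp: flow_forward_orbit_def)
  with W have "l \<in> W" unfolding window_def by (metis disjoint_insert(1) inf_bot_left inf_commute)
  with l_fixed show ?thesis by blast
qed

theorem corollary2:
  fixes W :: "(real ^ 'n) set"
  shows "(\<forall>f :: real ^ 'n \<Rightarrow> real ^ 'n.
            continuous_on UNIV f \<and> window (map_forward_orbit f) W \<longrightarrow>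
            (\<exists>p\<in>W. f p = p)) \<and>
         (\<forall>\<phi> :: real \<Rightarrow> real ^ 'n \<Rightarrow> real ^ 'n.
            continuous_flow \<phi> \<and> window (flow_forward_orbit \<phi>) W \<longrightarrow>
            (\<exists>p\<in>W. \<forall>t. \<phi> t p = p))"
  using map_window_fixed_point flow_window_fixed_point by blast

end
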